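(* Let $\Theta=(\theta_1,\dots,\theta_n):\mathbb D\to\overline{\mathbf{\Theta}}_n$ be a rational $\mathbf{\Theta}_n$-inner function of degree $pk$ (that is, $\theta_n$ has degree $k$). Then there exist polynomials $E_1,\dots,E_{n-1}$ and $D$ satisfying: (1) $\deg(E_i)\le pk$ for $1\le i\le n-1$, and $\deg(D)\le k$; (2) $D(z)\ne0$ for every $z\in\overline{\mathbb D}$; (3) $\theta_i=\dfrac{E_i}{D^p}$ for $1\le i\le n-1$, and $\theta_n=\dfrac{D^{\sim k}}{D}$ on $\overline{\mathbb D}$; (4) $|E_i(z)|\le k(i)\,|D(z)|^p$ for all $z\in\overline{\mathbb D}$ and $1\le i\le n-1$; (5) $E_i=E_{n-i}^{\sim pk}$ for $1\le i\le n-1$. Moreover, another collection of polynomials $E_1',\dots,E_{n-1}'$ and $D'$ satisfies (1)--(5) (for the same $\Theta$) if and only if there exists $t\in\mathbb R\setminus\{0\}$ such that $D'=tD$ and $E_i'=t^pE_i$ for $1\le i\le n-1$.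
   Context: $\mathbb D$ is the open unit disc, $\mathbb T$ the unit circle. Fix positive integers $m,p$ with $p$ dividing $m$, and $n\ge2$. Let $s_i$ be the $i$-th elementary symmetric polynomial in $n$ variables. Define $\theta=(\theta_1,\dots,\theta_n):\mathbb C^n\to\mathbb C^n$ by $\theta_i(z)=s_i(z_1^m,\dots,z_n^m)$ for $1\le i\le n-1$ and $\theta_n(z)=(z_1\cdots z_n)^{m/p}$, and set $\mathbf{\Theta}_n=\theta(\mathbb D^n)$, $\overline{\mathbf{\Theta}}_n=\theta(\overline{\mathbb D}^n)$. The distinguished boundary $b\mathbf{\Theta}_n$ is the Shilov boundary of $\overline{\mathbf{\Theta}}_n$, i.e. the smallest closed subset of $\overline{\mathbf{\Theta}}_n$ on which every function continuous on $\overline{\mathbf{\Theta}}_n$ and holomorphic in $\mathbf{\Theta}_n$ attains its maximum modulus (it is known to equal $\theta(\mathbb T^n)$). A $\mathbf{\Theta}_n$-inner function is a holomorphic map $\Theta:\mathbb D\to\overline{\mathbf{\Theta}}_n$ such that $\lim_{r\to1^-}\Theta(r\zeta)\in b\mathbf{\Theta}_n$ for Lebesgue-a.e. $\zeta\in\mathbb T$; it is rational if all its components are rational functions. For a rational $\mathbf{\Theta}_n$-inner function the last component $\theta_n$ is a rational inner function, i.e. a finite Blaschke product; its degree is the number of Blaschke factors, and $\deg(\Theta):=p\deg(\theta_n)$. For a polynomial $h$ of degree at most $d$, $h^{\sim d}(z)=z^d\,\overline{h(1/\overline z)}$. Finally $k(i)=\binom{n-1}{i}+\binom{n-1}{n-i}$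 (the notation $k(i)$ is unrelated to the integer $k$). *)

theory Defs
  imports "HOL-Complex_Analysis.Complex_Analysis" "HOL-Computational_Algebra.Computational_Algebra"
begin

text \<open>
  Points of \<open>\<complex>\<^sup>n\<close> are functions \<open>nat \<Rightarrow> complex\<close> vanishing outside \<open>{1..n}\<close>; on this subset the
  product topology of the function type is the Euclidean topology of \<open>\<complex>\<^sup>n\<close>.
\<close>

definition polydisc :: "nat \<Rightarrow> (nat \<Rightarrow> complex) set" where
  "polydisc n = {z. (\<forall>i\<in>{1..n}. norm (z i) < 1) \<and> (\<forall>i. i \<notin> {1..n} \<longrightarrow> z i = 0)}"

definition closed_polydisc :: "nat \<Rightarrow> (nat \<Rightarrow> complex) set" where
  "closed_polydisc n = {z. (\<forall>i\<in>{1..n}. norm (z i) \<le> 1) \<and> (\<forall>i. i \<notin> {1..n} \<longrightarrow> z i = 0)}"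

definition elem_sym :: "nat \<Rightarrow> nat \<Rightarrow> (nat \<Rightarrow> complex) \<Rightarrow> complex" where
  "elem_sym n i z = (\<Sum>S | S \<subseteq> {1..n} \<and> card S = i. \<Prod>j\<in>S. z j)"

definition theta_map :: "nat \<Rightarrow> nat \<Rightarrow> nat \<Rightarrow> (nat \<Rightarrow> complex) \<Rightarrow> (nat \<Rightarrow> complex)" where
  "theta_map m p n z = (\<lambda>i.
     if i \<in> {1..<n} then elem_sym n i (\<lambda>j. z j ^ m)
     else if i = n then (\<Prod>j=1..n. z j) ^ (m div p)
     else 0)"

definition Theta_dom :: "nat \<Rightarrow> nat \<Rightarrow> nat \<Rightarrow> (nat \<Rightarrow> complex) set" where
  "Theta_dom m p n = theta_map m p n ` polydisc n"

definition closed_Theta_dom :: "nat \<Rightarrow> nat \<Rightarrow> nat \<Rightarrow> (nat \<Rightarrow> complex) set" where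
  "closed_Theta_dom m p n = theta_map m p n ` closed_polydisc n"

text \<open>
  Holomorphy in \<open>n\<close> variables on an open subset \<open>U\<close> of \<open>\<complex>\<^sup>n\<close>: at every point of \<open>U\<close> there is a
  complex-linear total derivative, with coefficients \<open>a 1, \<dots>, a n\<close>.
\<close>

definition holomorphic_Cn :: "nat \<Rightarrow> ((nat \<Rightarrow> complex) \<Rightarrow> complex) \<Rightarrow> (nat \<Rightarrow> complex) set \<Rightarrow> bool" where
  "holomorphic_Cn n f U \<longleftrightarrow>
     (\<forall>z\<in>U. \<exists>a :: nat \<Rightarrow> complex.
        ((\<lambda>w. (f w - f z - (\<Sum>i=1..n. a i * (w i - z i))) / of_real (\<Sum>i=1..n. norm (w i - z i)))
          \<longlongrightarrow> 0) (at z within U))"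

definition closed_boundary :: "nat \<Rightarrow> nat \<Rightarrow> nat \<Rightarrow> (nat \<Rightarrow> complex) set \<Rightarrow> bool" where
  "closed_boundary m p n K \<longleftrightarrow>
     K \<subseteq> closed_Theta_dom m p n \<and> closed K \<and>
     (\<forall>f :: (nat \<Rightarrow> complex) \<Rightarrow> complex.
        continuous_on (closed_Theta_dom m p n) f \<and> holomorphic_Cn n f (Theta_dom m p n) \<longrightarrow>
        (\<exists>x\<in>K. \<forall>y\<in>closed_Theta_dom m p n. norm (f y) \<le> norm (f x)))"

text \<open>
  The Shilov boundary is the smallest closed boundary, hence the intersection of all of them; see
  \<open>distinguished_boundary_eq\<close> below.
\<close>

definition distinguished_boundary :: "nat \<Rightarrow> nat \<Rightarrow> nat \<Rightarrow> (nat \<Rightarrow> complex) set" where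
  "distinguished_boundary m p n = \<Inter> {K. closed_boundary m p n K}"

lemma distinguished_boundary_eq:
  assumes "closed_boundary m p n B" and "\<And>K. closed_boundary m p n K \<Longrightarrow> B \<subseteq> K"
  shows "distinguished_boundary m p n = B"
  using assms unfolding distinguished_boundary_def by blast

text \<open>
  A map into \<open>\<complex>\<^sup>n\<close> is written \<open>\<Phi> z i\<close> (component \<open>i\<close> at \<open>z\<close>). Only its values on the open unit
  disc matter.
\<close>

definition Theta_inner :: "nat \<Rightarrow> nat \<Rightarrow> nat \<Rightarrow> (complex \<Rightarrow> nat \<Rightarrow> complex) \<Rightarrow> bool" where
  "Theta_inner m p n \<Phi> \<longleftrightarrow>
     (\<forall>i\<in>{1..n}. (\<lambda>z. \<Phi> z i) holomorphic_on ball 0 1) \<and>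
     (\<forall>z\<in>ball 0 1. \<Phi> z \<in> closed_Theta_dom m p n) \<and>
     (AE t in lebesgue_on {0..2*pi}.
        \<exists>w\<in>distinguished_boundary m p n.
          ((\<lambda>r::real. \<Phi> (of_real r * cis t)) \<longlongrightarrow> w) (at_left 1))"

definition rational_on_disc :: "(complex \<Rightarrow> complex) \<Rightarrow> bool" where
  "rational_on_disc f \<longleftrightarrow>
     (\<exists>P Q :: complex poly. \<forall>z\<in>ball 0 1. poly Q z \<noteq> 0 \<and> f z = poly P z / poly Q z)"

definition rational_Theta_inner :: "nat \<Rightarrow> nat \<Rightarrow> nat \<Rightarrow> (complex \<Rightarrow> nat \<Rightarrow> complex) \<Rightarrow> bool" where
  "rational_Theta_inner m p n \<Phi> \<longleftrightarrow>
     Theta_inner m p n \<Phi> \<and> (\<forall>i\<in>{1..n}. rational_on_disc (\<lambda>z. \<Phi> z i))"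

definition blaschke_product :: "nat \<Rightarrow> (complex \<Rightarrow> complex) \<Rightarrow> bool" where
  "blaschke_product k f \<longleftrightarrow>
     (\<exists>(c::complex) (a :: nat \<Rightarrow> complex). norm c = 1 \<and> (\<forall>j<k. norm (a j) < 1) \<and>
        (\<forall>z\<in>ball 0 1. f z = c * (\<Prod>j<k. (z - a j) / (1 - cnj (a j) * z))))"

text \<open>
  The number of Blaschke factors is determined by the function, so \<open>LEAST\<close> merely selects it.
\<close>

definition blaschke_degree :: "(complex \<Rightarrow> complex) \<Rightarrow> nat" where
  "blaschke_degree f = (LEAST k. blaschke_product k f)"

definition inner_degree :: "nat \<Rightarrow> nat \<Rightarrow> (complex \<Rightarrow> nat \<Rightarrow> complex) \<Rightarrow> nat" where
  "inner_degree p n \<Phi> = p * blaschke_degree (\<lambda>z. \<Phi> z n)"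

text \<open>
  \<open>tilde d h\<close> is the polynomial \<open>z\<^sup>d \<cdot> cnj (h (1 / cnj z))\<close>, given by its coefficients so that it is
  also defined at \<open>0\<close>; it is meant for \<open>degree h \<le> d\<close>.
\<close>

definition tilde :: "nat \<Rightarrow> complex poly \<Rightarrow> complex poly" where
  "tilde d h = (\<Sum>i\<le>d. monom (cnj (coeff h i)) (d - i))"

lemma poly_tilde:
  assumes "degree h \<le> d" and "z \<noteq> 0"
  shows "poly (tilde d h) z = z ^ d * cnj (poly h (1 / cnj z))"
proof -
  have "poly h (1 / cnj z) = (\<Sum>i\<le>d. coeff h i * (1 / cnj z) ^ i)"
    unfolding poly_altdef using assms(1)
    by (intro sum.mono_neutral_left) (auto simp: not_le coeff_eq_0)
  then have "z ^ d * cnj (poly h (1 / cnj z)) = (\<Sum>i\<le>d. cnj (coeff h i) * (z ^ d * (1 / z) ^ i))"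
    by (simp add: sum_distrib_left mult_ac)
  also have "\<dots> = (\<Sum>i\<le>d. cnj (coeff h i) * z ^ (d - i))"
    using assms(2) by (intro sum.cong) (auto simp: power_diff power_one_over)
  also have "\<dots> = poly (tilde d h) z"
    by (simp add: tilde_def poly_sum poly_monom)
  finally show ?thesis by simp
qed

text \<open>
  Equality on the closed disc of a function \<open>f\<close> given on the open disc with a function \<open>g\<close>: at
  points of the unit circle \<open>f\<close> stands for its continuous extension.
\<close>

definition eq_on_closed_disc :: "(complex \<Rightarrow> complex) \<Rightarrow> (complex \<Rightarrow> complex) \<Rightarrow> bool" where
  "eq_on_closed_disc f g \<longleftrightarrow>
     (\<forall>z\<in>ball 0 1. f z = g z) \<and> (\<forall>z\<in>sphere 0 1. (f \<longlongrightarrow> g z) (at z within ball 0 1))"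

definition inner_representation ::
  "nat \<Rightarrow> nat \<Rightarrow> nat \<Rightarrow> (complex \<Rightarrow> nat \<Rightarrow> complex) \<Rightarrow> (nat \<Rightarrow> complex poly) \<Rightarrow> complex poly \<Rightarrow> bool" where
  "inner_representation p n k \<Phi> E D \<longleftrightarrow>
     (\<forall>i\<in>{1..n-1}. degree (E i) \<le> p * k) \<and> degree D \<le> k \<and>
     (\<forall>z\<in>cball 0 1. poly D z \<noteq> 0) \<and>
     (\<forall>i\<in>{1..n-1}. eq_on_closed_disc (\<lambda>z. \<Phi> z i) (\<lambda>z. poly (E i) z / poly D z ^ p)) \<and>
     eq_on_closed_disc (\<lambda>z. \<Phi> z n) (\<lambda>z. poly (tilde k D) z / poly D z) \<and>
     (\<forall>i\<in>{1..n-1}. \<forall>z\<in>cball 0 1.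
        norm (poly (E i) z) \<le> real ((n-1 choose i) + (n-1 choose (n-i))) * norm (poly D z) ^ p) \<and>
     (\<forall>i\<in>{1..n-1}. E i = tilde (p * k) (E (n - i)))"

end

theory Submission
  imports Defs "HOL-Computational_Algebra.Field_as_Ring"
begin

text \<open>
  Write \<open>\<theta>\<close> for \<open>theta_map m p n\<close>. Everything rests on two identities for points
  \<open>w = \<theta>(x)\<close> with all \<open>\<bar>x\<^sub>j\<bar> = 1\<close>: \<open>\<bar>w\<^sub>n\<bar> = 1\<close>, and
  \<open>w\<^sub>i = cnj w\<^sub>n\<^sub>-\<^sub>i \<cdot> w\<^sub>n ^ p\<close>, because conjugation inverts each \<open>x\<^sub>j\<close> and so
  exchanges complementary subsets in the elementary symmetric functions
  (\<open>torus_image_relations\<close>). The maximum principle, applied in one variable at a time to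
  \<open>f \<circ> \<theta>\<close>, shows that the distinguished boundary lies in the image of the torus
  (\<open>distinguished_boundary_subset_torus_image\<close>); the identities therefore hold for the radial
  limits of \<open>\<Phi>\<close> at almost every point of the circle. An infinite set of such points
  suffices, since from then on the argument compares polynomials.

  Each component is bounded, so in lowest terms it is \<open>P\<^sub>i / Q\<^sub>i\<close> with \<open>Q\<^sub>i\<close> free of zeros on the
  closed disc. The first identity makes the last component unimodular on the circle, and comparing
  \<open>P \<cdot> P\<^sup>~ = Q \<cdot> Q\<^sup>~\<close> shows that it is a finite Blaschke product
  (\<open>unimodular_rational_is_blaschke\<close>). The product of the \<open>1 - cnj a\<^sub>j \<cdot> z\<close> over its \<open>k\<close> factors,
  times a square root that absorbs the unimodular constant, is \<open>D\<close>. The second identity becomes a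
  polynomial identity in which \<open>Q\<^sub>i\<close> divides \<open>P\<^sub>i \<cdot> D ^ p\<close> times a polynomial whose zeros all lie
  in the open disc; hence \<open>Q\<^sub>i\<close> divides \<open>D ^ p\<close>
  (\<open>reflected_quotient_denominator_dvd\<close>) and \<open>E\<^sub>i = \<theta>\<^sub>i \<cdot> D ^ p\<close> is a polynomial. On the circle the
  same identity reads \<open>E\<^sub>i(z) = z ^ (p k) \<cdot> cnj (E\<^sub>n\<^sub>-\<^sub>i(z))\<close>, which gives both the degree
  bound and the symmetry (\<open>reflection_on_circle\<close>). The estimate for \<open>E\<^sub>i\<close> is the triangle
  inequality for the \<open>n choose i\<close> terms of an elementary symmetric function.

  For uniqueness, \<open>D\<close> and \<open>D\<^sup>~\<close> have no common zero, so two denominators with the same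
  quotient \<open>D\<^sup>~ / D\<close> divide each other. They differ by a constant \<open>c\<close> with \<open>cnj c = c\<close>, and
  \<open>D\<close> determines the \<open>E\<^sub>i\<close>.
\<close>

section \<open>The distinguished boundary and the image of the torus\<close>

definition polytorus :: "nat \<Rightarrow> (nat \<Rightarrow> complex) set" where
  "polytorus n = {z. (\<forall>i\<in>{1..n}. norm (z i) = 1) \<and> (\<forall>i. i \<notin> {1..n} \<longrightarrow> z i = 0)}"

lemma compact_coordinatewise:
  fixes S :: "nat \<Rightarrow> complex set"
  assumes "\<And>i. compact (S i)"
  shows "compact {z. \<forall>i. z i \<in> S i}"
proof -
  have "compactin (product_topology (\<lambda>i. euclidean) UNIV) (PiE UNIV S)"
    using assms by (subst compactin_PiE) auto
  moreover have "PiE UNIV S = {z. \<forall>i. z i \<in> S i}" by auto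
  ultimately show ?thesis by (simp add: euclidean_product_topology)
qed

text \<open>
  The topology of \<open>nat \<Rightarrow> complex\<close> is the product topology, so a limit of points of \<open>\<complex>\<^sup>n\<close> gives
  the limits of the components of an inner map.
\<close>
lemma tendsto_coordinatewise:
  fixes f :: "'a \<Rightarrow> nat \<Rightarrow> complex"
  shows "(f \<longlongrightarrow> l) F \<longleftrightarrow> (\<forall>i. ((\<lambda>x. f x i) \<longlongrightarrow> l i) F)"
  using limitin_componentwise[of "\<lambda>i::nat. euclidean :: complex topology" UNIV f l F]
  by (simp add: euclidean_product_topology)

lemma compact_closed_polydisc: "compact (closed_polydisc n)"
proof -
  have "closed_polydisc n = {z. \<forall>i. z i \<in> (if i \<in> {1..n} then cball 0 1 else {0})}"
    unfolding closed_polydisc_def by auto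
  then show ?thesis by (simp only:) (rule compact_coordinatewise, auto)
qed

lemma compact_polytorus: "compact (polytorus n)"
proof -
  have "polytorus n = {z. \<forall>i. z i \<in> (if i \<in> {1..n} then sphere 0 1 else {0})}"
    unfolding polytorus_def by auto
  then show ?thesis by (simp only:) (rule compact_coordinatewise, auto)
qed

lemma continuous_on_theta_map: "continuous_on S (theta_map m p n)"
proof (rule continuous_on_coordinatewise_then_product)
  fix i
  have c: "continuous_on S (\<lambda>z::nat \<Rightarrow> complex. z j)" for j
    by (rule continuous_on_subset[OF continuous_on_product_coordinates]) simp
  show "continuous_on S (\<lambda>x. theta_map m p n x i)"
    unfolding theta_map_def elem_sym_def
    by (cases "i \<in> {1..<n}"; cases "i = n") (auto intro!: continuous_intros c)
qed

lemma theta_map_coordinate_holomorphic: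
  "(\<lambda>u. theta_map m p n (z(j := u)) i) holomorphic_on S"
proof -
  have c: "(\<lambda>u. (z(j := u)) l) holomorphic_on S" for l
    by (cases "l = j") auto
  show ?thesis
    unfolding theta_map_def elem_sym_def
    by (cases "i \<in> {1..<n}"; cases "i = n") (auto intro!: holomorphic_intros c simp del: fun_upd_apply)
qed

lemma polydisc_upd:
  assumes "z \<in> polydisc n" "j \<in> {1..n}" "norm u < 1"
  shows "z(j := u) \<in> polydisc n"
  using assms by (auto simp: polydisc_def)

text \<open>
  The chain rule along one coordinate. As a coordinate varies in the open disc, the image under
  \<open>\<theta>\<close> stays in \<open>Theta_dom m p n\<close>, so a derivative of \<open>f\<close> within that set is enough.
\<close>
lemma holomorphic_Cn_compose_theta:
  assumes f: "holomorphic_Cn n f (Theta_dom m p n)"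
    and z: "z \<in> polydisc n" and j: "j \<in> {1..n}"
  shows "(\<lambda>u. f (theta_map m p n (z(j := u)))) holomorphic_on ball 0 1"
  unfolding holomorphic_on_open[OF open_ball]
proof (intro ballI)
  fix u :: complex assume u: "u \<in> ball 0 1"
  define U where "U = Theta_dom m p n"
  define w where "w = (\<lambda>v. theta_map m p n (z(j := v)))"
  have wU: "w v \<in> U" if "v \<in> ball 0 1" for v
    using polydisc_upd[OF z j, of v] that by (auto simp: w_def U_def Theta_dom_def)
  obtain a where a: "((\<lambda>x. (f x - f (w u) - (\<Sum>i=1..n. a i * (x i - w u i))) /
      of_real (\<Sum>i=1..n. norm (x i - w u i))) \<longlongrightarrow> 0) (at (w u) within U)"
    using f wU[OF u] unfolding holomorphic_Cn_def U_def by blast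
  define num where "num = (\<lambda>x. f x - f (w u) - (\<Sum>i=1..n. a i * (x i - w u i)))"
  define N where "N = (\<lambda>x::nat \<Rightarrow> complex. \<Sum>i=1..n. norm (x i - w u i))"
  define q where "q = (\<lambda>x. num x / of_real (N x))"
  have qu: "q (w u) = 0" by (simp add: q_def num_def)
  \<comment> \<open>Division by zero makes \<open>q\<close> vanish at \<open>w u\<close> itself, so that \<open>q\<close> can be composed with \<open>w\<close>
    although \<open>w\<close> may return to the value \<open>w u\<close> near \<open>u\<close>.\<close>
  have cq: "continuous (at (w u) within U) q"
    using a unfolding continuous_within qu by (simp add: q_def num_def N_def)
  have hol: "(\<lambda>v. w v i) holomorphic_on ball 0 1" for i
    unfolding w_def by (rule theta_map_coordinate_holomorphic)
  have "\<exists>d. \<forall>i. ((\<lambda>v. w v i) has_field_derivative d i) (at u)"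
    using hol u by (intro choice) (auto simp: holomorphic_on_open)
  then obtain d where d: "\<And>i. ((\<lambda>v. w v i) has_field_derivative d i) (at u)" by blast
  have quot: "((\<lambda>v. (w v i - w u i) / (v - u)) \<longlongrightarrow> d i) (at u)" for i
    using d[of i] by (simp add: has_field_derivative_iff)
  have evU: "\<forall>\<^sub>F v in at u. w v \<in> U"
    using eventually_at_in_open'[OF open_ball u] by eventually_elim (rule wU)
  have cw: "(w \<longlongrightarrow> w u) (at u)"
  proof -
    have "continuous_on (ball 0 1) w"
      using hol by (intro continuous_on_coordinatewise_then_product holomorphic_on_imp_continuous_on)
    then show ?thesis
      using u by (simp add: continuous_on_eq_continuous_at isCont_def)
  qed
  have ql: "((\<lambda>v. q (w v)) \<longlongrightarrow> 0) (at u)"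
    using continuous_within_tendsto_compose[OF cq evU cw] by (simp add: qu)
  have rem: "((\<lambda>v. num (w v) / (v - u)) \<longlongrightarrow> 0) (at u)"
  proof (rule tendsto_norm_zero_cancel, rule Lim_transform_eventually)
    have "((\<lambda>v. norm (q (w v)) * (\<Sum>i=1..n. norm ((w v i - w u i) / (v - u)))) \<longlongrightarrow>
        norm (0::complex) * (\<Sum>i=1..n. norm (d i))) (at u)"
      by (intro tendsto_intros ql quot)
    then show "((\<lambda>v. norm (q (w v)) * (\<Sum>i=1..n. norm ((w v i - w u i) / (v - u)))) \<longlongrightarrow> 0) (at u)"
      by simp
    show "\<forall>\<^sub>F v in at u. norm (q (w v)) * (\<Sum>i=1..n. norm ((w v i - w u i) / (v - u)))
        = norm (num (w v) / (v - u))"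
      using evU
    proof eventually_elim
      case (elim v)
      have "num (w v) = 0" if "N (w v) = 0"
      proof -
        have "\<forall>i\<in>{1..n}. w v i = w u i"
          using that by (simp add: N_def sum_nonneg_eq_0_iff)
        moreover have "w v i = w u i" if "i \<notin> {1..n}" for i
          using that by (auto simp: w_def theta_map_def j)
        ultimately have "w v = w u" by blast
        then show ?thesis by (simp add: num_def)
      qed
      moreover have "(\<Sum>i=1..n. norm ((w v i - w u i) / (v - u))) = N (w v) / norm (v - u)"
        by (simp add: N_def norm_divide sum_divide_distrib)
      moreover have "N (w v) \<ge> 0" by (simp add: N_def sum_nonneg)
      ultimately show ?case
        by (cases "N (w v) = 0") (auto simp: q_def norm_divide)
    qed
  qed
  have "((\<lambda>v. num (w v) / (v - u) + (\<Sum>i=1..n. a i * ((w v i - w u i) / (v - u)))) \<longlongrightarrow>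
      0 + (\<Sum>i=1..n. a i * d i)) (at u)"
    by (intro tendsto_intros rem quot)
  moreover have "num (w v) / (v - u) + (\<Sum>i=1..n. a i * ((w v i - w u i) / (v - u))) =
      (f (w v) - f (w u)) / (v - u)" for v
  proof -
    have "(\<Sum>i=1..n. a i * ((w v i - w u i) / (v - u))) = (\<Sum>i=1..n. a i * (w v i - w u i)) / (v - u)"
      by (simp add: sum_divide_distrib)
    then show ?thesis by (simp only: num_def add_divide_distrib[symmetric]) simp
  qed
  ultimately have "((\<lambda>v. f (w v)) has_field_derivative (\<Sum>i=1..n. a i * d i)) (at u)"
    by (simp add: has_field_derivative_iff)
  then show "\<exists>f'. ((\<lambda>u. f (theta_map m p n (z(j := u)))) has_field_derivative f') (at u)"
    unfolding w_def by blast
qed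

text \<open>
  By the maximum principle in one variable, each coordinate in turn can be moved to the circle of
  radius \<open>r\<close> without decreasing \<open>\<bar>g\<bar>\<close>. A radius below \<open>1\<close> keeps every slice inside the
  open polydisc, where \<open>g\<close> is holomorphic in each variable.
\<close>
lemma maximum_modulus_polydisc:
  assumes hol: "\<And>z j. z \<in> polydisc n \<Longrightarrow> j \<in> {1..n} \<Longrightarrow>
      (\<lambda>u. g (z(j := u))) holomorphic_on ball 0 1"
    and r: "0 < r" "r < 1"
    and z: "\<And>i. i \<in> {1..n} \<Longrightarrow> norm (z i) \<le> r" "\<And>i. i \<notin> {1..n} \<Longrightarrow> z i = 0"
  shows "\<exists>w. (\<forall>i\<in>{1..n}. norm (w i) = r) \<and> (\<forall>i. i \<notin> {1..n} \<longrightarrow> w i = 0) \<and>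
      norm (g z) \<le> norm (g w :: complex)"
proof -
  have "\<exists>w. (\<forall>i\<in>J. norm (w i) = r) \<and> (\<forall>i. i \<notin> J \<longrightarrow> w i = z i) \<and> norm (g z) \<le> norm (g w)"
    if "finite J" "J \<subseteq> {1..n}" for J
    using that
  proof (induction J)
    case empty
    then show ?case by auto
  next
    case (insert j J)
    then obtain w where w: "\<forall>i\<in>J. norm (w i) = r" "\<forall>i. i \<notin> J \<longrightarrow> w i = z i"
      "norm (g z) \<le> norm (g w)" by auto
    have wr: "norm (w i) \<le> r" if "i \<in> {1..n}" for i
      using w(1,2) z(1)[OF that] by (cases "i \<in> J") auto
    have "w \<in> polydisc n"
      unfolding polydisc_def
    proof (intro CollectI conjI ballI allI impI)
      fix i assume "i \<in> {1..n}"
      then show "norm (w i) < 1" using wr r(2) le_less_trans by blast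
    next
      fix i assume "i \<notin> {1..n}"
      then show "w i = 0" using w(2) z(2) insert.prems by (metis insert_subset subset_iff)
    qed
    then have h: "(\<lambda>u. g (w(j := u))) holomorphic_on ball 0 1"
      using insert.prems by (intro hol) auto
    then have c: "continuous_on (cball 0 r) (\<lambda>u. g (w(j := u)))"
      using r by (intro continuous_on_subset[OF holomorphic_on_imp_continuous_on[OF h]]) auto
    obtain v where v: "v \<in> sphere 0 r"
      "\<And>u. u \<in> sphere 0 r \<Longrightarrow> norm (g (w(j := u))) \<le> norm (g (w(j := v)))"
    proof -
      have "continuous_on (sphere 0 r) (\<lambda>u. norm (g (w(j := u))))"
        by (intro continuous_on_norm continuous_on_subset[OF c]) auto
      then show ?thesis
        using continuous_attains_sup[of "sphere 0 r" "\<lambda>u. norm (g (w(j := u)))"] r that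
        by auto
    qed
    have "norm (g (w(j := w j))) \<le> norm (g (w(j := v)))"
    proof (rule maximum_modulus_frontier[of "\<lambda>u. g (w(j := u))" "cball 0 r"])
      show "(\<lambda>u. g (w(j := u))) holomorphic_on interior (cball 0 r)"
        using r by (intro holomorphic_on_subset[OF h]) auto
    qed (use c v wr insert.prems r in auto)
    then have "norm (g w) \<le> norm (g (w(j := v)))" by (simp only: fun_upd_triv)
    with w(3) have "norm (g z) \<le> norm (g (w(j := v)))" by (rule order_trans)
    moreover have "\<forall>i\<in>insert j J. norm ((w(j := v)) i) = r" "\<forall>i. i \<notin> insert j J \<longrightarrow> (w(j := v)) i = z i"
      using w(1,2) v(1) by auto
    ultimately show ?case by blast
  qed
  from this[of "{1..n}"] obtain w where
    "\<forall>i\<in>{1..n}. norm (w i) = r" "\<forall>i. i \<notin> {1..n} \<longrightarrow> w i = z i" "norm (g z) \<le> norm (g w)" by auto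
  with z(2) show ?thesis by (intro exI[of _ w]) auto
qed

text \<open>
  Apply the previous lemma to dilations of a maximising point with radii tending to \<open>1\<close>. Compactness
  of the torus yields a limit of the points found at these radii, and continuity of \<open>g\<close> on the closed
  polydisc passes the inequality to the limit.
\<close>
lemma polydisc_maximum_on_polytorus:
  fixes g :: "(nat \<Rightarrow> complex) \<Rightarrow> complex"
  assumes cont: "continuous_on (closed_polydisc n) g"
    and hol: "\<And>z j. z \<in> polydisc n \<Longrightarrow> j \<in> {1..n} \<Longrightarrow>
      (\<lambda>u. g (z(j := u))) holomorphic_on ball 0 1"
  shows "\<exists>w\<in>polytorus n. \<forall>z\<in>closed_polydisc n. norm (g z) \<le> norm (g w)"
proof -
  have "(\<lambda>_. 0) \<in> closed_polydisc n" by (simp add: closed_polydisc_def)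
  then obtain z where z: "z \<in> closed_polydisc n"
    and zmax: "\<And>y. y \<in> closed_polydisc n \<Longrightarrow> norm (g y) \<le> norm (g z)"
    using continuous_attains_sup[OF compact_closed_polydisc _ continuous_on_norm[OF cont]] by blast
  define r where "r = (\<lambda>k::nat. real (Suc k) / real (Suc (Suc k)))"
  have r: "0 < r k" "r k < 1" for k by (auto simp: r_def)
  have rlim: "r \<longlonglongrightarrow> 1"
    unfolding r_def using LIMSEQ_Suc[OF LIMSEQ_n_over_Suc_n] by simp
  define s where "s = (\<lambda>k (y::nat \<Rightarrow> complex) i. of_real (r k) * y i)"
  have "\<exists>x\<in>polytorus n. norm (g (s k z)) \<le> norm (g (s k x))" for k
  proof -
    have "\<exists>w. (\<forall>i\<in>{1..n}. norm (w i) = r k) \<and> (\<forall>i. i \<notin> {1..n} \<longrightarrow> w i = 0) \<and>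
      norm (g (s k z)) \<le> norm (g w)"
      using z r[of k]
      by (intro maximum_modulus_polydisc hol) 
        (auto simp: s_def closed_polydisc_def norm_mult intro!: mult_left_le)
    then obtain w where w: "\<forall>i\<in>{1..n}. norm (w i) = r k" "\<forall>i. i \<notin> {1..n} \<longrightarrow> w i = 0"
      "norm (g (s k z)) \<le> norm (g w)" by blast
    define x where "x = (\<lambda>i. w i / of_real (r k))"
    have "x \<in> polytorus n" using w r[of k] by (auto simp: x_def polytorus_def norm_divide)
    moreover have "s k x = w" using r[of k] by (auto simp: s_def x_def)
    ultimately show ?thesis using w(3) by auto
  qed
  then obtain x where x: "\<And>k. x k \<in> polytorus n" "\<And>k. norm (g (s k z)) \<le> norm (g (s k (x k)))"
    by metis
  obtain w \<sigma> where w: "w \<in> polytorus n" and \<sigma>: "strict_mono \<sigma>" and xw: "(x \<circ> \<sigma>) \<longlonglongrightarrow> w"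
    using compact_polytorus[of n] x(1) unfolding compact_eq_seq_compact_metric seq_compact_def by metis
  have r\<sigma>: "(\<lambda>k. r (\<sigma> k)) \<longlonglongrightarrow> 1"
    using LIMSEQ_subseq_LIMSEQ[OF rlim \<sigma>] by (simp add: o_def)
  have scl: "s k y \<in> closed_polydisc n" if "y \<in> closed_polydisc n" for k y
    using that r[of k] less_imp_le[OF r(2)[of k]]
    by (auto simp: s_def closed_polydisc_def norm_mult intro!: mult_le_one)
  have tc: "polytorus n \<subseteq> closed_polydisc n" by (auto simp: polytorus_def closed_polydisc_def)
  have lim: "(\<lambda>k. s (\<sigma> k) (y k)) \<longlonglongrightarrow> l" if "y \<longlonglongrightarrow> l" for y and l :: "nat \<Rightarrow> complex"
  proof (rule tendsto_coordinatewise[THEN iffD2], rule allI)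
    fix i
    have "(\<lambda>k. y k i) \<longlonglongrightarrow> l i" using that by (rule tendsto_coordinatewise[THEN iffD1, rule_format])
    then have "(\<lambda>k. of_real (r (\<sigma> k)) * y k i) \<longlonglongrightarrow> of_real 1 * l i"
      by (intro tendsto_intros r\<sigma>)
    then show "(\<lambda>k. s (\<sigma> k) (y k) i) \<longlonglongrightarrow> l i" by (simp add: s_def)
  qed
  have glim: "(\<lambda>k. norm (g (s (\<sigma> k) (y k)))) \<longlonglongrightarrow> norm (g l)"
    if "y \<longlonglongrightarrow> l" "l \<in> closed_polydisc n" "\<And>k. y k \<in> closed_polydisc n" for y l
    using that lim[OF that(1)] scl cont
    by (intro tendsto_norm continuous_on_tendsto_compose[OF cont]) auto
  have "norm (g z) \<le> norm (g w)"
  proof (rule LIMSEQ_le)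
    show "(\<lambda>k. norm (g (s (\<sigma> k) z))) \<longlonglongrightarrow> norm (g z)"
      using glim[of "\<lambda>_. z" z] z by simp
    show "(\<lambda>k. norm (g (s (\<sigma> k) (x (\<sigma> k))))) \<longlonglongrightarrow> norm (g w)"
      using glim[of "x \<circ> \<sigma>" w] xw x(1) w tc by auto
  qed (use x(2) in auto)
  with w zmax show ?thesis by (meson order_trans)
qed

text \<open>
  The image of the torus is one of the closed sets over which the intersection is taken. Each
  admissible \<open>f\<close> becomes, after composition with \<open>\<theta>\<close>, a function on the closed polydisc that is
  continuous and holomorphic in each variable.
\<close>
lemma distinguished_boundary_subset_torus_image:
  "distinguished_boundary m p n \<subseteq> theta_map m p n ` polytorus n"
proof -
  have tc: "polytorus n \<subseteq> closed_polydisc n" by (auto simp: polytorus_def closed_polydisc_def)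
  have "\<exists>x\<in>theta_map m p n ` polytorus n. \<forall>y\<in>closed_Theta_dom m p n. norm (f y) \<le> norm (f x)"
    if f: "continuous_on (closed_Theta_dom m p n) f" "holomorphic_Cn n f (Theta_dom m p n)" for f
  proof -
    have "continuous_on (closed_polydisc n) (\<lambda>z. f (theta_map m p n z))"
      by (rule continuous_on_compose2[OF f(1) continuous_on_theta_map]) (simp add: closed_Theta_dom_def)
    then have "\<exists>w\<in>polytorus n. \<forall>z\<in>closed_polydisc n.
        norm (f (theta_map m p n z)) \<le> norm (f (theta_map m p n w))"
      by (intro polydisc_maximum_on_polytorus holomorphic_Cn_compose_theta[OF f(2)])
    then show ?thesis by (auto simp: closed_Theta_dom_def)
  qed
  moreover have "closed (theta_map m p n ` polytorus n)"
    by (intro compact_imp_closed compact_continuous_image continuous_on_theta_map compact_polytorus)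
  ultimately have "closed_boundary m p n (theta_map m p n ` polytorus n)"
    unfolding closed_boundary_def using tc by (auto simp: closed_Theta_dom_def)
  then show ?thesis unfolding distinguished_boundary_def by blast
qed

section \<open>Symmetric functions on the torus and on the closed polydisc\<close>

text \<open>
  On the torus the product over \<open>S\<close> is the full product times the conjugate of the product over
  the complement of \<open>S\<close>, and complementation exchanges \<open>i\<close>-subsets with \<open>(n - i)\<close>-subsets.
\<close>
lemma elem_sym_conjugate_reciprocal:
  assumes x: "\<And>j. j \<in> {1..n} \<Longrightarrow> norm (x j) = 1" and i: "i \<le> n"
  shows "elem_sym n i x = cnj (elem_sym n (n - i) x) * (\<Prod>j=1..n. x j)"
proof -
  have complement: "(\<Prod>j\<in>S. x j) = cnj (\<Prod>j\<in>{1..n}-S. x j) * (\<Prod>j=1..n. x j)" if S: "S \<subseteq> {1..n}" for S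
  proof -
    have "cnj (\<Prod>j\<in>{1..n}-S. x j) * (\<Prod>j\<in>{1..n}-S. x j) = (\<Prod>j\<in>{1..n}-S. cnj (x j) * x j)"
      by (simp add: prod.distrib)
    also have "\<dots> = 1"
    proof (rule prod.neutral, rule ballI)
      fix j assume "j \<in> {1..n} - S"
      then have "norm (x j) = 1" using x by blast
      then show "cnj (x j) * x j = 1"
        using complex_norm_square[of "x j"] by (simp add: mult.commute)
    qed
    finally have 1: "cnj (\<Prod>j\<in>{1..n}-S. x j) * (\<Prod>j\<in>{1..n}-S. x j) = 1" .
    have "(\<Prod>j=1..n. x j) = (\<Prod>j\<in>{1..n}-S. x j) * (\<Prod>j\<in>S. x j)"
      using S by (intro prod.subset_diff) auto
    with 1 show ?thesis by (metis mult.assoc mult.left_neutral)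
  qed
  have "elem_sym n i x = (\<Sum>S | S \<subseteq> {1..n} \<and> card S = n - i. \<Prod>j\<in>{1..n}-S. x j)"
    unfolding elem_sym_def
  proof (rule sum.reindex_bij_witness[where i = "\<lambda>S. {1..n} - S" and j = "\<lambda>S. {1..n} - S"])
    fix S assume "S \<in> {S. S \<subseteq> {1..n} \<and> card S = i}"
    then show "{1..n} - S \<in> {S. S \<subseteq> {1..n} \<and> card S = n - i}"
      by (auto simp: card_Diff_subset finite_subset)
  next
    fix S assume "S \<in> {S. S \<subseteq> {1..n} \<and> card S = n - i}"
    then show "{1..n} - S \<in> {S. S \<subseteq> {1..n} \<and> card S = i}"
      using i by (auto simp: card_Diff_subset finite_subset)
  qed (auto simp: double_diff)
  also have "\<dots> = (\<Sum>S | S \<subseteq> {1..n} \<and> card S = n - i. cnj (\<Prod>j\<in>S. x j) * (\<Prod>j=1..n. x j))"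
  proof (rule sum.cong)
    fix S assume "S \<in> {S. S \<subseteq> {1..n} \<and> card S = n - i}"
    then show "(\<Prod>j\<in>{1..n}-S. x j) = cnj (\<Prod>j\<in>S. x j) * (\<Prod>j=1..n. x j)"
      using complement[of "{1..n} - S"] by (simp add: double_diff)
  qed simp
  finally show ?thesis by (simp add: elem_sym_def sum_distrib_right)
qed

lemma torus_image_relations:
  assumes x: "x \<in> polytorus n" and p: "p dvd m"
  shows "norm (theta_map m p n x n) = 1"
    and "i \<in> {1..n-1} \<Longrightarrow>
      theta_map m p n x i = cnj (theta_map m p n x (n - i)) * theta_map m p n x n ^ p"
proof -
  have last: "theta_map m p n x n = (\<Prod>j=1..n. x j) ^ (m div p)"
    by (simp add: theta_map_def)
  have norm: "norm (x j) = 1" if "j \<in> {1..n}" for j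
    using x that by (auto simp: polytorus_def)
  show "norm (theta_map m p n x n) = 1"
    using norm by (simp add: last norm_power prod_norm[symmetric])
  assume i: "i \<in> {1..n-1}"
  have "(\<Prod>j=1..n. x j ^ m) = theta_map m p n x n ^ p"
    using p by (simp add: last power_mult[symmetric] prod_power_distrib)
  then show "theta_map m p n x i = cnj (theta_map m p n x (n - i)) * theta_map m p n x n ^ p"
    using i elem_sym_conjugate_reciprocal[of n "\<lambda>j. x j ^ m" i] norm
    by (auto simp: theta_map_def norm_power)
qed

lemma norm_elem_sym_le:
  assumes "\<And>j. j \<in> {1..n} \<Longrightarrow> norm (x j) \<le> 1"
  shows "norm (elem_sym n i x) \<le> real (n choose i)"
proof -
  have "norm (elem_sym n i x) \<le> (\<Sum>S | S \<subseteq> {1..n} \<and> card S = i. 1::real)"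
    unfolding elem_sym_def
  proof (rule sum_norm_le)
    fix S assume "S \<in> {S. S \<subseteq> {1..n} \<and> card S = i}"
    then show "norm (\<Prod>j\<in>S. x j) \<le> 1"
      using assms by (auto simp: prod_norm[symmetric] intro!: prod_le_1)
  qed
  also have "\<dots> = real (n choose i)" by (simp add: n_subsets)
  finally show ?thesis .
qed

text \<open>
  Pascal's rule, after rewriting the second summand by symmetry: the constant \<open>k(i)\<close> is simply the
  number of terms of the \<open>i\<close>-th elementary symmetric function.
\<close>
lemma choose_boundary_sum:
  assumes "i \<in> {1..n-1}"
  shows "(n-1 choose i) + (n-1 choose (n-i)) = n choose i"
proof -
  have "(n-1 choose (n-i)) = (n-1 choose (i-1))"
    using assms binomial_symmetric[of "i-1" "n-1"] by (auto simp: algebra_simps)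
  then show ?thesis
    using assms choose_reduce_nat[of n i] by force
qed

lemma closed_Theta_dom_bounds:
  assumes w: "w \<in> closed_Theta_dom m p n"
  shows "i \<in> {1..n-1} \<Longrightarrow> norm (w i) \<le> real ((n-1 choose i) + (n-1 choose (n-i)))"
    and "norm (w n) \<le> 1"
proof -
  obtain x where x: "x \<in> closed_polydisc n" "w = theta_map m p n x"
    using w by (auto simp: closed_Theta_dom_def)
  then have norm: "norm (x j) \<le> 1" if "j \<in> {1..n}" for j
    using that by (auto simp: closed_polydisc_def)
  {
    assume i: "i \<in> {1..n-1}"
    have "norm (elem_sym n i (\<lambda>j. x j ^ m)) \<le> real (n choose i)"
      using norm by (intro norm_elem_sym_le) (auto simp: norm_power intro!: power_le_one)
    then show "norm (w i) \<le> real ((n-1 choose i) + (n-1 choose (n-i)))"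
      using i unfolding choose_boundary_sum[OF i] x(2) by (auto simp: theta_map_def)
  }
  have "norm (\<Prod>j=1..n. x j) \<le> 1"
    using norm by (auto simp: prod_norm[symmetric] intro!: prod_le_1)
  then show "norm (w n) \<le> 1"
    by (auto simp: x(2) theta_map_def norm_power intro!: power_le_one)
qed

section \<open>Boundary values\<close>

text \<open>
  A set of angles of full measure cannot be finite. The angle \<open>2\<pi>\<close>, which \<open>Arg2pi\<close> never takes as a
  value, has to be added to the finite exceptional set.
\<close>
lemma infinite_torus_limits:
  assumes "Theta_inner m p n \<Phi>"
  shows "infinite {\<zeta>\<in>sphere 0 1. \<exists>x\<in>polytorus n.
    ((\<lambda>r::real. \<Phi> (of_real r * \<zeta>)) \<longlongrightarrow> theta_map m p n x) (at_left 1)}" (is "infinite ?X")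
proof
  assume fin: "finite ?X"
  define T where "T = insert (2*pi) (Arg2pi ` ?X)"
  have "finite T" using fin by (simp add: T_def)
  then have "negligible T" by (rule negligible_finite)
  then have "T \<in> null_sets lebesgue" by (simp add: negligible_iff_null_sets)
  then have T: "AE t in lebesgue. t \<notin> T" by (rule AE_not_in)
  have "AE t in lebesgue_on {0..2*pi}. t \<in> T"
  proof -
    have "AE t in lebesgue_on {0..2*pi}. \<exists>w\<in>distinguished_boundary m p n.
        ((\<lambda>r::real. \<Phi> (of_real r * cis t)) \<longlongrightarrow> w) (at_left 1)"
      using assms by (simp add: Theta_inner_def)
    moreover have "AE t in lebesgue_on {0..2*pi}. t \<in> {0..2*pi}"
      by (intro AE_I2) (simp add: space_restrict_space)
    ultimately show ?thesis
    proof eventually_elim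
      case (elim t)
      then have "cis t \<in> ?X"
        using distinguished_boundary_subset_torus_image[of m p n] by auto
      moreover have "Arg2pi (cis t) = t" if "t < 2*pi"
        using that elim by (intro Arg2pi_unique[of 1]) (auto simp: cis_conv_exp)
      ultimately show ?case
        using elim unfolding T_def by (cases "t < 2*pi") force+
    qed
  qed
  then have "AE t in lebesgue. t \<in> {0..2*pi} \<longrightarrow> t \<in> T"
    by (subst (asm) AE_restrict_space_iff) auto
  with T have "AE t in lebesgue. t \<notin> {0..2*pi}" by eventually_elim auto
  then have "{0..2*pi} \<in> null_sets lebesgue"
    by (subst AE_iff_null_sets) auto
  then show False by (simp add: null_sets_def)
qed

lemma eq_on_closed_discI:
  assumes "continuous_on (cball 0 1) g" "\<And>z. z \<in> ball 0 1 \<Longrightarrow> f z = g z"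
  shows "eq_on_closed_disc f g"
  unfolding eq_on_closed_disc_def
proof (intro conjI ballI)
  fix z :: complex assume z: "z \<in> sphere 0 1"
  then have "(g \<longlongrightarrow> g z) (at z within cball 0 1)"
    using assms(1) by (auto simp: continuous_on_def)
  then have "(g \<longlongrightarrow> g z) (at z within ball 0 1)"
    by (rule tendsto_within_subset) auto
  then show "(f \<longlongrightarrow> g z) (at z within ball 0 1)"
    by (rule Lim_transform_eventually) (auto simp: eventually_at_filter assms(2))
qed (use assms in auto)

lemma eq_on_closed_disc_radial_limit:
  assumes f: "eq_on_closed_disc f g" and \<zeta>: "\<zeta> \<in> sphere 0 1"
  shows "((\<lambda>r::real. f (of_real r * \<zeta>)) \<longlongrightarrow> g \<zeta>) (at_left 1)"
proof -
  have "((\<lambda>r::real. of_real r * \<zeta>) \<longlongrightarrow> of_real 1 * \<zeta>) (at_left 1)"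
    by (intro tendsto_intros)
  moreover have "\<forall>\<^sub>F r::real in at_left 1. 0 < r \<and> r < 1"
    by (rule eventually_at_leftI[of 0]) auto
  then have "\<forall>\<^sub>F r::real in at_left 1. of_real r * \<zeta> \<in> ball 0 1 \<and> of_real r * \<zeta> \<noteq> \<zeta>"
    by eventually_elim (use \<zeta> in \<open>auto simp: norm_mult\<close>)
  ultimately have "filterlim (\<lambda>r::real. of_real r * \<zeta>) (at \<zeta> within ball 0 1) (at_left 1)"
    by (simp add: filterlim_at)
  moreover have "(f \<longlongrightarrow> g \<zeta>) (at \<zeta> within ball 0 1)"
    using f \<zeta> by (auto simp: eq_on_closed_disc_def)
  ultimately show ?thesis by (rule filterlim_compose[rotated])
qed

section \<open>Polynomials and reflection in the unit circle\<close>

lemma poly_eqI_infinite: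
  fixes P Q :: "'a::idom poly"
  assumes "infinite X" "\<And>x. x \<in> X \<Longrightarrow> poly P x = poly Q x"
  shows "P = Q"
proof (rule ccontr)
  assume "P \<noteq> Q"
  then have "finite {x. poly (P - Q) x = 0}" by (intro poly_roots_finite) simp
  moreover have "X \<subseteq> {x. poly (P - Q) x = 0}" using assms(2) by auto
  ultimately show False using assms(1) finite_subset by blast
qed

lemma complex_poly_root:
  fixes P :: "complex poly"
  assumes "degree P > 0"
  shows "\<exists>z. poly P z = 0"
  using fundamental_theorem_of_algebra[of P] assms by (simp add: constant_degree)

lemma coprime_complex_polyI:
  fixes P Q :: "complex poly"
  assumes "\<And>z. poly P z = 0 \<Longrightarrow> poly Q z \<noteq> 0"
  shows "coprime P Q"
proof (rule coprimeI)
  fix c assume c: "c dvd P" "c dvd Q"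
  then have "poly c z \<noteq> 0" for z
    using assms[of z] by (auto elim!: dvdE)
  then have "degree c = 0" "c \<noteq> 0"
    using complex_poly_root[of c] by auto
  then show "is_unit c" by (simp add: is_unit_iff_degree)
qed

lemma coprime_poly_rootD:
  fixes P Q :: "complex poly"
  assumes "coprime P Q" "poly P z = 0"
  shows "poly Q z \<noteq> 0"
proof
  assume "poly Q z = 0"
  then have "is_unit [:-z, 1:]"
    using assms by (intro coprime_common_divisor[OF assms(1)]) (auto simp: poly_eq_0_iff_dvd)
  then show False by (simp add: is_unit_iff_degree)
qed

lemma coeff_tilde: "coeff (tilde d h) j = (if j \<le> d then cnj (coeff h (d - j)) else 0)"
proof -
  have "coeff (tilde d h) j = (\<Sum>i\<le>d. if d - i = j then cnj (coeff h i) else 0)"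
    by (simp add: tilde_def coeff_sum)
  also have "\<dots> = (\<Sum>i\<le>d. if j \<le> d \<and> i = d - j then cnj (coeff h i) else 0)"
    by (rule sum.cong) auto
  also have "\<dots> = (if j \<le> d then cnj (coeff h (d - j)) else 0)"
    by (auto simp: sum.delta)
  finally show ?thesis .
qed

lemma degree_tilde_le: "degree (tilde d h) \<le> d"
  by (rule degree_le) (simp add: coeff_tilde)

lemma tilde_smult: "tilde d (smult c h) = smult (cnj c) (tilde d h)"
  by (rule poly_eqI) (simp add: coeff_tilde)

lemma poly_tilde_circle:
  assumes "degree h \<le> d" "norm z = 1"
  shows "poly (tilde d h) z = z ^ d * cnj (poly h z)"
proof -
  have "z * cnj z = 1" using complex_norm_square[of z] assms(2) by simp
  moreover from this have "z \<noteq> 0" by auto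
  ultimately have "1 / cnj z = z" "z \<noteq> 0" by (simp_all add: divide_eq_eq)
  then show ?thesis using poly_tilde[OF assms(1)] by simp
qed

lemma tilde_root_reflects:
  assumes "degree h \<le> d" "z \<noteq> 0" "poly (tilde d h) z = 0"
  shows "poly h (1 / cnj z) = 0"
  using poly_tilde[OF assms(1,2)] assms(2,3) by simp

text \<open>
  The zeros of \<open>Q\<close> lie outside the closed disc, while those of the reflection of \<open>R\<close> are inside:
  a nonzero one is the mirror image of a zero of \<open>R\<close>.
\<close>
lemma coprime_tilde:
  assumes Q: "\<And>z. z \<in> cball 0 1 \<Longrightarrow> poly Q z \<noteq> 0" and R: "\<And>z. z \<in> cball 0 1 \<Longrightarrow> poly R z \<noteq> 0"
    and d: "degree R \<le> d"
  shows "coprime Q (tilde d R)"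
proof (rule coprime_complex_polyI, rule notI)
  fix z assume z: "poly Q z = 0" "poly (tilde d R) z = 0"
  then have "norm z > 1" using Q[of z] by force
  then have "1 / cnj z \<in> cball 0 1" "z \<noteq> 0" by (auto simp: norm_divide divide_le_eq)
  with tilde_root_reflects[OF d _ z(2)] R show False by blast
qed

text \<open>
  If \<open>B\<close> has degree larger than \<open>N\<close>, its reflection has to be taken with respect to some \<open>M > N\<close>; the
  surplus power of \<open>z\<close> then shows up as a factor in front of \<open>A\<close>, and the bound \<open>M\<close> for the degree
  of a reflection leaves only \<open>N\<close> for \<open>A\<close>. Two such relations, with \<open>A\<close> and
  \<open>B\<close> exchanged, therefore bound both degrees by \<open>N\<close> before either reflection is identified.
\<close>
lemma reflection_on_circle:
  assumes X: "infinite X" "X \<subseteq> sphere 0 1"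
    and eq: "\<And>z. z \<in> X \<Longrightarrow> poly A z = z ^ N * cnj (poly B z)"
  shows "degree A \<le> N"
    and "degree B \<le> N \<Longrightarrow> A = tilde N B"
proof -
  define M where "M = max N (degree B)"
  have M: "N \<le> M" "degree B \<le> M" by (auto simp: M_def)
  have "monom 1 (M - N) * A = tilde M B"
  proof (rule poly_eqI_infinite[OF X(1)])
    fix z assume z: "z \<in> X"
    then have "poly (tilde M B) z = z ^ M * cnj (poly B z)"
      using X(2) M(2) by (intro poly_tilde_circle) auto
    also have "z ^ M = z ^ (M - N) * z ^ N" using M(1) by (simp add: power_add[symmetric])
    finally show "poly (monom 1 (M - N) * A) z = poly (tilde M B) z"
      using eq[OF z] by (simp add: poly_monom)
  qed
  then have "degree (monom 1 (M - N) * A) \<le> M" by (simp add: degree_tilde_le)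
  then show "degree A \<le> N"
    using M(1) by (cases "A = 0") (auto simp: degree_mult_eq degree_monom_eq)
  show "A = tilde N B" if "degree B \<le> N"
    using X eq that by (intro poly_eqI_infinite[OF X(1)]) (auto simp: poly_tilde_circle subset_iff)
qed

lemma poly_norm_le_extends_to_circle:
  fixes P Q :: "complex poly"
  assumes "\<And>z. z \<in> ball 0 1 \<Longrightarrow> norm (poly P z) \<le> M * norm (poly Q z)" and "z \<in> cball 0 1"
  shows "norm (poly P z) \<le> M * norm (poly Q z)"
proof -
  have "closed {z. norm (poly P z) \<le> M * norm (poly Q z)}"
    by (intro closed_Collect_le continuous_intros)
  then have "closure (ball 0 1) \<subseteq> {z. norm (poly P z) \<le> M * norm (poly Q z)}"
    using assms(1) by (intro closure_minimal) auto
  then show ?thesis using assms(2) by auto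
qed

text \<open>
  A zero of \<open>Q\<close> on the circle would be a zero of \<open>P\<close> as well, by the bound
  \<open>\<bar>P\<bar> \<le> M \<cdot> \<bar>Q\<bar>\<close>, which extends to the closed disc; this is impossible in lowest terms.
\<close>
lemma bounded_rational_reduced:
  assumes f: "rational_on_disc f" and M: "\<And>z. z \<in> ball 0 1 \<Longrightarrow> norm (f z) \<le> M"
  shows "\<exists>P Q. coprime P Q \<and> (\<forall>z\<in>cball 0 1. poly Q z \<noteq> 0) \<and> (\<forall>z\<in>ball 0 1. f z = poly P z / poly Q z)"
proof -
  obtain P0 Q0 where PQ0: "\<And>z. z \<in> ball 0 1 \<Longrightarrow> poly Q0 z \<noteq> 0 \<and> f z = poly P0 z / poly Q0 z"
    using f unfolding rational_on_disc_def by blast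
  then have "Q0 \<noteq> 0" by (metis centre_in_ball poly_0 zero_less_one)
  then have "gcd P0 Q0 \<noteq> 0" by simp
  from gcd_coprime_exists[OF this] obtain P Q where PQ: "P0 = P * gcd P0 Q0" "Q0 = Q * gcd P0 Q0"
    "coprime P Q" by blast
  have Qb: "poly Q z \<noteq> 0" and fz: "f z = poly P z / poly Q z" if "z \<in> ball 0 1" for z
  proof -
    have "poly Q z * poly (gcd P0 Q0) z \<noteq> 0" using PQ0[OF that] PQ(2) by (metis poly_mult)
    then show "poly Q z \<noteq> 0" "f z = poly P z / poly Q z"
      using PQ0[OF that] PQ(1,2) by (auto, metis mult_divide_mult_cancel_right poly_mult)
  qed
  have "norm (poly P z) \<le> M * norm (poly Q z)" if "z \<in> cball 0 1" for z
  proof (rule poly_norm_le_extends_to_circle[OF _ that])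
    fix z :: complex assume "z \<in> ball 0 1"
    then show "norm (poly P z) \<le> M * norm (poly Q z)"
      using M[of z] fz[of z] Qb[of z] by (simp add: norm_divide divide_le_eq)
  qed
  then have "poly Q z \<noteq> 0" if "z \<in> cball 0 1" for z
    using that coprime_poly_rootD[of Q P z] PQ(3) by (force simp: coprime_commute)
  with PQ(3) fz show ?thesis by blast
qed

section \<open>Finite Blaschke products\<close>

text \<open>
  The zeros of \<open>Q\<close> are the \<open>1 / cnj (a j)\<close> with \<open>a j \<noteq> 0\<close>. Choosing \<open>a j = 0\<close>, with factor \<open>1\<close>,
  makes up for a degree below \<open>d\<close>, so that a Blaschke product may vanish at the origin.
\<close>
lemma poly_factorization_outside_disc:
  fixes Q :: "complex poly"
  assumes "degree Q \<le> d" "\<And>z. z \<in> cball 0 1 \<Longrightarrow> poly Q z \<noteq> 0"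
  shows "\<exists>c a. c \<noteq> 0 \<and> (\<forall>j<d. norm (a j) < 1) \<and> Q = smult c (\<Prod>j<d. [:1, - cnj (a j):])"
  using assms
proof (induction d arbitrary: Q)
  case 0
  then obtain c where "Q = [:c:]" by (auto elim: degree_eq_zeroE)
  with 0(2)[of 0] show ?case by (intro exI[of _ c]) auto
next
  case (Suc d)
  show ?case
  proof (cases "degree Q \<le> d")
    case True
    from Suc.IH[OF this Suc.prems(2)] obtain c a where
      "c \<noteq> 0" "\<forall>j<d. norm (a j) < 1" "Q = smult c (\<Prod>j<d. [:1, - cnj (a j):])" by auto
    then show ?thesis
      by (intro exI[of _ c] exI[of _ "a(d := 0)"]) (auto simp: less_Suc_eq)
  next
    case False
    then obtain w where w: "poly Q w = 0" using complex_poly_root[of Q] by auto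
    then obtain Q' where Q': "Q = [:-w, 1:] * Q'" by (auto simp: poly_eq_0_iff_dvd)
    have nw: "norm w > 1" using w Suc.prems(2)[of w] by force
    then have w0: "w \<noteq> 0" by auto
    have "Q' \<noteq> 0" using Q' False by auto
    then have "degree Q' \<le> d" using Suc.prems(1) by (simp add: Q' degree_mult_eq del: mult_pCons_left)
    moreover have "poly Q' z \<noteq> 0" if "z \<in> cball 0 1" for z
      using Suc.prems(2)[OF that] by (auto simp: Q')
    ultimately obtain c a where ca: "c \<noteq> 0" "\<forall>j<d. norm (a j) < 1"
      "Q' = smult c (\<Prod>j<d. [:1, - cnj (a j):])" using Suc.IH[of Q'] by auto
    have "[:-w, 1:] = smult (-w) [:1, - (1/w):]" using w0 by simp
    then have "Q = smult (c * (-w)) ((\<Prod>j<d. [:1, - cnj (a j):]) * [:1, - (1/w):])"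
      unfolding Q' ca(3) by (simp only: mult_smult_left mult_smult_right smult_smult mult.commute)
    with ca(1,2) w0 nw show ?thesis
      by (intro exI[of _ "c * (-w)"] exI[of _ "a(d := cnj (1/w))"])
        (auto simp: less_Suc_eq norm_divide simp del: mult_pCons_left mult_pCons_right)
  qed
qed

lemma tilde_blaschke_denominator:
  "tilde d (smult c (\<Prod>j<d. [:1, - cnj (a j):])) = smult (cnj c) (\<Prod>j<d. [:- a j, 1:])"
proof (rule poly_eqI_infinite[of "- {0}"])
  show "infinite (- {0::complex})" using infinite_UNIV_char_0 by (simp add: finite_compl)
  fix z :: complex assume "z \<in> - {0}"
  then have z: "z \<noteq> 0" by simp
  have "degree (\<Prod>j<d. [:1, - cnj (a j):]) \<le> sum (degree \<circ> (\<lambda>j. [:1, - cnj (a j):])) {..<d}"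
    by (rule degree_prod_sum_le) simp
  also have "\<dots> \<le> (\<Sum>j<d. 1)" by (intro sum_mono) simp
  finally have "degree (smult c (\<Prod>j<d. [:1, - cnj (a j):])) \<le> d"
    by (intro order_trans[OF degree_smult_le]) simp
  then have "poly (tilde d (smult c (\<Prod>j<d. [:1, - cnj (a j):]))) z
      = cnj c * (z ^ d * (\<Prod>j<d. 1 - a j / z))"
    using z by (simp add: poly_tilde poly_prod)
  also have "z ^ d * (\<Prod>j<d. 1 - a j / z) = (\<Prod>j<d. z * (1 - a j / z))"
    by (simp add: prod.distrib)
  also have "\<dots> = (\<Prod>j<d. z - a j)" using z by (simp add: right_diff_distrib)
  finally show "poly (tilde d (smult c (\<Prod>j<d. [:1, - cnj (a j):]))) z
      = poly (smult (cnj c) (\<Prod>j<d. [:- a j, 1:])) z"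
    by (simp add: poly_prod)
qed

text \<open>
  Scaling the denominator by \<open>b\<close> multiplies its reflection by \<open>cnj b\<close>, hence the quotient by
  \<open>cnj b / b\<close>. For unimodular \<open>b\<close> this is \<open>cnj b ^ 2\<close>, so a square root \<open>b\<close> of \<open>cnj c\<close>
  produces the constant \<open>c\<close> of the Blaschke product.
\<close>
lemma blaschke_product_denominator:
  assumes "blaschke_product k f"
  shows "\<exists>D. degree D \<le> k \<and> (\<forall>z\<in>cball 0 1. poly D z \<noteq> 0) \<and>
    (\<forall>z\<in>ball 0 1. f z = poly (tilde k D) z / poly D z)"
proof -
  obtain c a where c: "norm c = 1" and a: "\<forall>j<k. norm (a j) < 1"
    and f: "\<forall>z\<in>ball 0 1. f z = c * (\<Prod>j<k. (z - a j) / (1 - cnj (a j) * z))"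
    using assms unfolding blaschke_product_def by blast
  define b where "b = csqrt (cnj c)"
  have b2: "b * b = cnj c" unfolding b_def by (metis power2_csqrt power2_eq_square)
  have "norm b ^ 2 = 1" using c b2 by (metis complex_mod_cnj norm_mult power2_eq_square)
  then have nb: "norm b = 1" using norm_ge_zero[of b] by (simp add: power2_eq_1_iff)
  have b1: "b * cnj b = 1" using complex_norm_square[of b] nb by simp
  then have b0: "b \<noteq> 0" by auto
  have "cnj b * cnj b = c" using b2 by (metis complex_cnj_cnj complex_cnj_mult)
  then have "b * c = (b * cnj b) * cnj b" by simp
  then have cb: "cnj b / b = c" using b1 b0 by (simp add: divide_eq_eq mult.commute)
  define D where "D = smult b (\<Prod>j<k. [:1, - cnj (a j):])"
  have "degree (\<Prod>j<k. [:1, - cnj (a j):]) \<le> sum (degree \<circ> (\<lambda>j. [:1, - cnj (a j):])) {..<k}"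
    by (rule degree_prod_sum_le) simp
  also have "\<dots> \<le> (\<Sum>j<k. 1)" by (intro sum_mono) simp
  finally have "degree D \<le> k"
    unfolding D_def by (intro order_trans[OF degree_smult_le]) simp
  moreover have "poly D z \<noteq> 0" if z: "z \<in> cball 0 1" for z
  proof -
    have "1 - cnj (a j) * z \<noteq> 0" if "j < k" for j
    proof
      assume "1 - cnj (a j) * z = 0"
      then have "norm (a j) * norm z = 1" by (metis complex_mod_cnj eq_iff_diff_eq_0 norm_mult norm_one)
      moreover have "norm (a j) * norm z \<le> norm (a j)" using z by (intro mult_left_le) auto
      ultimately show False using a that by fastforce
    qed
    then show ?thesis using b0 by (auto simp: D_def poly_prod mult.commute)
  qed
  moreover have "f z = poly (tilde k D) z / poly D z" if "z \<in> ball 0 1" for z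
  proof -
    have "poly (tilde k D) z / poly D z = cnj b / b * ((\<Prod>j<k. z - a j) / (\<Prod>j<k. 1 - cnj (a j) * z))"
      unfolding D_def tilde_blaschke_denominator by (simp add: poly_prod mult.commute)
    then show ?thesis using f that by (simp add: cb prod_dividef)
  qed
  ultimately show ?thesis by blast
qed

text \<open>
  On the circle \<open>\<bar>P\<bar> = \<bar>Q\<bar>\<close> says that \<open>P \<cdot> P\<^sup>~ = Q \<cdot> Q\<^sup>~\<close>. As \<open>P\<close> and \<open>Q\<close> are coprime,
  \<open>Q\<^sup>~ = P \<cdot> R\<close> and \<open>P\<^sup>~ = Q \<cdot> R\<close>. A nonzero zero of \<open>R\<close> would reflect to a common zero of
  \<open>P\<close> and \<open>Q\<close>, and a zero at \<open>0\<close> would mean that both degrees are below \<open>d\<close>, their maximum. So \<open>R\<close> is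
  constant and \<open>P\<close> is a multiple of the reflection of \<open>Q\<close>.
\<close>
lemma unimodular_rational_is_blaschke:
  assumes PQ: "coprime P Q" "\<And>z. z \<in> cball 0 1 \<Longrightarrow> poly Q z \<noteq> 0"
    and f: "\<And>z. z \<in> ball 0 1 \<Longrightarrow> f z = poly P z / poly Q z"
    and X: "infinite X" "X \<subseteq> sphere 0 1" and uni: "\<And>z. z \<in> X \<Longrightarrow> norm (poly P z) = norm (poly Q z)"
  shows "\<exists>d. blaschke_product d f"
proof -
  define d where "d = max (degree P) (degree Q)"
  have d: "degree P \<le> d" "degree Q \<le> d" by (auto simp: d_def)
  obtain x where x: "x \<in> X" using X(1) by fastforce
  have Qx: "poly Q x \<noteq> 0" using x X(2) PQ(2) by force
  then have Q0: "Q \<noteq> 0" and P0: "P \<noteq> 0" using uni[OF x] by auto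
  have "P * tilde d P = Q * tilde d Q"
  proof (rule poly_eqI_infinite[OF X(1)])
    fix z assume z: "z \<in> X"
    have "poly P z * cnj (poly P z) = poly Q z * cnj (poly Q z)"
      using uni[OF z] by (metis complex_norm_square)
    then show "poly (P * tilde d P) z = poly (Q * tilde d Q) z"
      using z X(2) d by (auto simp: poly_tilde_circle subset_iff mult.left_commute)
  qed
  then have "P dvd Q * tilde d Q" by (metis dvd_triv_left)
  then have "P dvd tilde d Q" using PQ(1) by (simp add: coprime_dvd_mult_right_iff)
  then obtain R where R: "tilde d Q = P * R" by auto
  with \<open>P * tilde d P = Q * tilde d Q\<close> have R': "tilde d P = Q * R"
    using P0 by (metis mult.left_commute mult_left_cancel)
  have "degree R = 0"
  proof (rule ccontr)
    assume "degree R \<noteq> 0"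
    then obtain w where "poly R w = 0" using complex_poly_root by blast
    then have w: "poly (tilde d P) w = 0" "poly (tilde d Q) w = 0" using R R' by auto
    show False
    proof (cases "w = 0")
      case True
      then have "coeff P d = 0" "coeff Q d = 0"
        using w by (simp_all add: poly_0_coeff_0 coeff_tilde)
      then show False using P0 Q0 unfolding d_def by (auto simp: max_def split: if_splits)
    next
      case False
      then show False
        using tilde_root_reflects[OF d(1) False w(1)] tilde_root_reflects[OF d(2) False w(2)]
          coprime_poly_rootD[OF PQ(1)] by blast
    qed
  qed
  then obtain r where "R = [:r:]" by (rule degree_eq_zeroE)
  then have r: "tilde d Q = smult r P" using R by simp
  have "norm x = 1" using x X(2) by auto
  then have "norm (poly Q x) = norm (poly (tilde d Q) x)"
    using d by (simp add: poly_tilde_circle norm_mult norm_power)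
  also have "\<dots> = norm r * norm (poly Q x)" using uni[OF x] by (simp add: r norm_mult)
  finally have nr: "norm r = 1" using Qx by simp
  then have r0: "r \<noteq> 0" by auto
  obtain c a where c0: "c \<noteq> 0" and a: "\<forall>j<d. norm (a j) < 1"
    and Q: "Q = smult c (\<Prod>j<d. [:1, - cnj (a j):])"
    using poly_factorization_outside_disc[OF d(2) PQ(2)] by blast
  have "smult r P = smult (cnj c) (\<Prod>j<d. [:- a j, 1:])"
    using r tilde_blaschke_denominator[of d c a] unfolding Q by simp
  then have "poly (smult r P) z = poly (smult (cnj c) (\<Prod>j<d. [:- a j, 1:])) z" for z by simp
  then have P: "poly P z = cnj c / r * (\<Prod>j<d. z - a j)" for z
    using r0 by (simp add: poly_prod field_simps)
  have "f z = cnj c / (r * c) * (\<Prod>j<d. (z - a j) / (1 - cnj (a j) * z))" if "z \<in> ball 0 1" for z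
    using f[OF that] unfolding P by (simp add: Q poly_prod prod_dividef mult.commute)
  moreover have "norm (cnj c / (r * c)) = 1"
    using nr c0 by (simp add: norm_divide norm_mult)
  ultimately show ?thesis unfolding blaschke_product_def using a by blast
qed

section \<open>Rational inner maps\<close>

text \<open>
  Clearing denominators and replacing conjugates by reflections turns the relation into
  \<open>P1 \<cdot> F \<cdot> Q2\<^sup>~ = P2\<^sup>~ \<cdot> G \<cdot> Q1\<close>. Here \<open>Q1\<close> is coprime to \<open>P1\<close> and to \<open>Q2\<^sup>~\<close>. It is applied with
  \<open>F = D ^ p\<close> and \<open>G\<close> the \<open>p\<close>-th power of the reflection of \<open>D\<close>.
\<close>
lemma reflected_quotient_denominator_dvd:
  fixes P1 Q1 P2 Q2 D :: "complex poly"
  assumes PQ: "coprime P1 Q1"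
    and Q1: "\<And>z. z \<in> cball 0 1 \<Longrightarrow> poly Q1 z \<noteq> 0" and Q2: "\<And>z. z \<in> cball 0 1 \<Longrightarrow> poly Q2 z \<noteq> 0"
    and X: "infinite X" "X \<subseteq> sphere 0 1"
    and eq: "\<And>z. z \<in> X \<Longrightarrow>
      poly P1 z / poly Q1 z * poly F z = cnj (poly P2 z / poly Q2 z) * poly G z"
  shows "Q1 dvd F"
proof -
  define d where "d = max (degree P2) (degree Q2)"
  have d: "degree P2 \<le> d" "degree Q2 \<le> d" by (auto simp: d_def)
  have "P1 * F * tilde d Q2 = tilde d P2 * G * Q1"
  proof (rule poly_eqI_infinite[OF X(1)])
    fix z assume z: "z \<in> X"
    then have n: "norm z = 1" and Q0: "poly Q1 z \<noteq> 0" "poly Q2 z \<noteq> 0"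
      using X(2) Q1[of z] Q2[of z] by auto
    have "poly P1 z * poly F z * cnj (poly Q2 z) = cnj (poly P2 z) * poly G z * poly Q1 z"
      using eq[OF z] Q0 by (simp add: field_simps)
    then show "poly (P1 * F * tilde d Q2) z = poly (tilde d P2 * G * Q1) z"
      using n d by (simp add: poly_tilde_circle mult_ac)
  qed
  then have "Q1 dvd P1 * (F * tilde d Q2)" by (metis dvd_triv_right mult.assoc)
  then have "Q1 dvd F * tilde d Q2"
    using PQ by (simp add: coprime_dvd_mult_right_iff coprime_commute)
  moreover have "coprime Q1 (tilde d Q2)" by (rule coprime_tilde[OF Q1 Q2 d(2)])
  ultimately show ?thesis by (simp add: coprime_dvd_mult_left_iff)
qed

text \<open>
  The polynomial \<open>E i\<close> is \<open>P i \<cdot> D ^ p / Q i\<close>, where the division is exact by the previous lemma.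
\<close>
lemma inner_representation_exists:
  assumes mp: "p > 0" "p dvd m" and n: "n \<ge> 2"
    and \<Phi>: "rational_Theta_inner m p n \<Phi>" and deg: "inner_degree p n \<Phi> = p * k"
  shows "\<exists>E D. inner_representation p n k \<Phi> E D"
proof -
  have inner: "Theta_inner m p n \<Phi>" and rat: "\<And>i. i \<in> {1..n} \<Longrightarrow> rational_on_disc (\<lambda>z. \<Phi> z i)"
    using \<Phi> by (auto simp: rational_Theta_inner_def)
  have dom: "\<Phi> z \<in> closed_Theta_dom m p n" if "z \<in> ball 0 1" for z
    using inner that by (simp add: Theta_inner_def)
  define M where "M = (\<lambda>i. if i = n then 1 else real ((n-1 choose i) + (n-1 choose (n-i))))"
  have bound: "norm (\<Phi> z i) \<le> M i" if "z \<in> ball 0 1" "i \<in> {1..n}" for z i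
    using closed_Theta_dom_bounds[OF dom[OF that(1)]] that(2) n by (auto simp: M_def)
  have "\<forall>i\<in>{1..n}. \<exists>P Q. coprime P Q \<and> (\<forall>z\<in>cball 0 1. poly Q z \<noteq> 0) \<and>
      (\<forall>z\<in>ball 0 1. \<Phi> z i = poly P z / poly Q z)"
    using bounded_rational_reduced[OF rat bound] by blast
  then obtain P Q where cop: "\<And>i. i \<in> {1..n} \<Longrightarrow> coprime (P i) (Q i)"
    and Q: "\<And>i z. i \<in> {1..n} \<Longrightarrow> z \<in> cball 0 1 \<Longrightarrow> poly (Q i) z \<noteq> 0"
    and val: "\<And>i z. i \<in> {1..n} \<Longrightarrow> z \<in> ball 0 1 \<Longrightarrow> \<Phi> z i = poly (P i) z / poly (Q i) z"
    by metis
  define X where "X = {\<zeta>\<in>sphere 0 1. \<exists>x\<in>polytorus n.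
    ((\<lambda>r::real. \<Phi> (of_real r * \<zeta>)) \<longlongrightarrow> theta_map m p n x) (at_left 1)}"
  have X: "infinite X" "X \<subseteq> sphere 0 1"
    using infinite_torus_limits[OF inner] by (auto simp: X_def)
  have lim: "w i = g \<zeta>"
    if "\<zeta> \<in> X" "((\<lambda>r::real. \<Phi> (of_real r * \<zeta>)) \<longlongrightarrow> w) (at_left 1)" "eq_on_closed_disc (\<lambda>z. \<Phi> z i) g"
    for \<zeta> w i g
  proof (rule tendsto_unique[of "at_left (1::real)"])
    show "((\<lambda>r::real. \<Phi> (of_real r * \<zeta>) i) \<longlongrightarrow> w i) (at_left 1)"
      using that(2) by (simp add: tendsto_coordinatewise)
    show "((\<lambda>r::real. \<Phi> (of_real r * \<zeta>) i) \<longlongrightarrow> g \<zeta>) (at_left 1)"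
      using that(1) X(2) by (intro eq_on_closed_disc_radial_limit[OF that(3)]) auto
  qed simp
  have extPQ: "eq_on_closed_disc (\<lambda>z. \<Phi> z i) (\<lambda>z. poly (P i) z / poly (Q i) z)" if "i \<in> {1..n}" for i
    using Q[OF that] val[OF that] by (intro eq_on_closed_discI continuous_intros) auto
  have nn: "n \<in> {1..n}" using n by simp
  have "\<exists>d. blaschke_product d (\<lambda>z. \<Phi> z n)"
  proof (rule unimodular_rational_is_blaschke[OF cop[OF nn] Q[OF nn] val[OF nn] X])
    fix \<zeta> assume \<zeta>: "\<zeta> \<in> X"
    then obtain x where x: "x \<in> polytorus n"
      "((\<lambda>r::real. \<Phi> (of_real r * \<zeta>)) \<longlongrightarrow> theta_map m p n x) (at_left 1)"
      unfolding X_def by blast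
    have "norm (poly (P n) \<zeta> / poly (Q n) \<zeta>) = 1"
      using lim[OF \<zeta> x(2) extPQ[OF nn]] torus_image_relations(1)[OF x(1) mp(2)] by simp
    then show "norm (poly (P n) \<zeta>) = norm (poly (Q n) \<zeta>)"
      by (auto simp: norm_divide divide_eq_eq split: if_splits)
  qed
  moreover have "blaschke_degree (\<lambda>z. \<Phi> z n) = k"
    using deg mp(1) by (simp add: inner_degree_def)
  \<comment> \<open>\<open>LEAST\<close> says nothing until some \<open>d\<close> is known to qualify.\<close>
  ultimately have "blaschke_product k (\<lambda>z. \<Phi> z n)"
    unfolding blaschke_degree_def by (metis LeastI)
  from blaschke_product_denominator[OF this] obtain D where D: "degree D \<le> k"
    "\<And>z. z \<in> cball 0 1 \<Longrightarrow> poly D z \<noteq> 0"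
    "\<And>z. z \<in> ball 0 1 \<Longrightarrow> \<Phi> z n = poly (tilde k D) z / poly D z" by blast
  have extD: "eq_on_closed_disc (\<lambda>z. \<Phi> z n) (\<lambda>z. poly (tilde k D) z / poly D z)"
    using D by (intro eq_on_closed_discI continuous_intros) auto
  have rel: "poly (P i) \<zeta> / poly (Q i) \<zeta> * poly (D ^ p) \<zeta> =
      cnj (poly (P (n-i)) \<zeta> / poly (Q (n-i)) \<zeta>) * poly (tilde k D ^ p) \<zeta>"
    if \<zeta>: "\<zeta> \<in> X" and i: "i \<in> {1..n-1}" for \<zeta> i
  proof -
    obtain x where x: "x \<in> polytorus n"
      "((\<lambda>r::real. \<Phi> (of_real r * \<zeta>)) \<longlongrightarrow> theta_map m p n x) (at_left 1)"
      using \<zeta> unfolding X_def by blast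
    have i': "i \<in> {1..n}" "n - i \<in> {1..n}" using i by auto
    have "poly D \<zeta> \<noteq> 0" using \<zeta> X(2) by (intro D(2)) auto
    moreover have "poly (P i) \<zeta> / poly (Q i) \<zeta> =
        cnj (poly (P (n-i)) \<zeta> / poly (Q (n-i)) \<zeta>) * (poly (tilde k D) \<zeta> / poly D \<zeta>) ^ p"
      using torus_image_relations(2)[OF x(1) mp(2) i]
      unfolding lim[OF \<zeta> x(2) extPQ[OF i'(1)]] lim[OF \<zeta> x(2) extPQ[OF i'(2)]] lim[OF \<zeta> x(2) extD]
      by simp
    ultimately show ?thesis by (simp add: power_divide)
  qed
  have dvd: "Q i dvd D ^ p" if i: "i \<in> {1..n-1}" for i
  proof -
    have i': "i \<in> {1..n}" "n - i \<in> {1..n}" using i by auto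
    show ?thesis
      by (rule reflected_quotient_denominator_dvd[OF cop[OF i'(1)] Q[OF i'(1)] Q[OF i'(2)] X rel[OF _ i]])
  qed
  define E where "E = (\<lambda>i. P i * (D ^ p div Q i))"
  have E: "poly (E i) z = poly (P i) z / poly (Q i) z * poly D z ^ p"
    if i: "i \<in> {1..n-1}" and z: "z \<in> cball 0 1" for i z
  proof -
    have "poly (D ^ p div Q i) z * poly (Q i) z = poly D z ^ p"
      using dvd[OF i] by (metis dvd_div_mult_self poly_mult poly_power)
    moreover have "poly (Q i) z \<noteq> 0" using i z by (intro Q) auto
    ultimately show ?thesis by (simp add: E_def field_simps)
  qed
  have reflect: "poly (E i) \<zeta> = \<zeta> ^ (p * k) * cnj (poly (E (n-i)) \<zeta>)"
    if \<zeta>: "\<zeta> \<in> X" and i: "i \<in> {1..n-1}" for \<zeta> i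
  proof -
    have i': "n - i \<in> {1..n-1}" using i by auto
    have z: "norm \<zeta> = 1" "\<zeta> \<in> cball 0 1" using \<zeta> X(2) by auto
    have "poly (E i) \<zeta> = cnj (poly (P (n-i)) \<zeta> / poly (Q (n-i)) \<zeta>) * (\<zeta> ^ k * cnj (poly D \<zeta>)) ^ p"
      using rel[OF \<zeta> i] E[OF i z(2)] D(1) z(1) by (simp add: poly_tilde_circle)
    also have "\<dots> = \<zeta> ^ (p * k) * cnj (poly (E (n-i)) \<zeta>)"
      unfolding E[OF i' z(2)] by (simp add: power_mult_distrib power_mult[symmetric] mult.commute)
    finally show ?thesis .
  qed
  have degE: "degree (E i) \<le> p * k" if "i \<in> {1..n-1}" for i
    by (rule reflection_on_circle(1)[OF X reflect[OF _ that]])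
  have val_E: "\<Phi> z i = poly (E i) z / poly D z ^ p" if i: "i \<in> {1..n-1}" and z: "z \<in> ball 0 1" for i z
    using val[of i z] E[OF i, of z] D(2)[of z] i z by auto
  have "inner_representation p n k \<Phi> E D"
    unfolding inner_representation_def
  proof (intro conjI ballI)
    fix i assume i: "i \<in> {1..n-1}"
    then have i': "n - i \<in> {1..n-1}" by auto
    show "degree (E i) \<le> p * k" by (rule degE[OF i])
    show "eq_on_closed_disc (\<lambda>z. \<Phi> z i) (\<lambda>z. poly (E i) z / poly D z ^ p)"
      using D(2) val_E[OF i] by (intro eq_on_closed_discI continuous_intros) auto
    show "E i = tilde (p * k) (E (n - i))"
      by (rule reflection_on_circle(2)[OF X reflect[OF _ i] degE[OF i']])
    fix z :: complex assume z: "z \<in> cball 0 1"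
    have "norm (poly (E i) z) \<le> real ((n-1 choose i) + (n-1 choose (n-i))) * norm (poly (D ^ p) z)"
    proof (rule poly_norm_le_extends_to_circle[OF _ z])
      fix z :: complex assume z: "z \<in> ball 0 1"
      have "poly (E i) z = \<Phi> z i * poly D z ^ p" using val_E[OF i z] D(2)[of z] z by simp
      moreover have "norm (\<Phi> z i) \<le> real ((n-1 choose i) + (n-1 choose (n-i)))"
        using closed_Theta_dom_bounds(1)[OF dom[OF z] i] .
      ultimately show "norm (poly (E i) z) \<le> real ((n-1 choose i) + (n-1 choose (n-i))) * norm (poly (D ^ p) z)"
        by (simp only: norm_mult norm_power poly_power mult_right_mono zero_le_power norm_ge_zero)
    qed
    then show "norm (poly (E i) z) \<le> real ((n-1 choose i) + (n-1 choose (n-i))) * norm (poly D z) ^ p"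
      by (simp add: norm_power)
  qed (use D extD in auto)
  then show ?thesis by blast
qed

section \<open>Uniqueness\<close>

text \<open>
  Cross-multiplication and coprimality of each denominator with its own reflection make \<open>D\<close> and \<open>D'\<close>
  divide each other, so \<open>D' = c D\<close>. The reflection of \<open>D'\<close> carries the factor \<open>cnj c\<close>; equality of
  the quotients forces \<open>cnj c = c\<close>.
\<close>
lemma blaschke_denominator_unique:
  assumes D: "degree D \<le> k" "\<And>z. z \<in> cball 0 1 \<Longrightarrow> poly D z \<noteq> 0"
    and D': "degree D' \<le> k" "\<And>z. z \<in> cball 0 1 \<Longrightarrow> poly D' z \<noteq> 0"
    and eq: "\<And>z. z \<in> ball 0 1 \<Longrightarrow> poly (tilde k D) z / poly D z = poly (tilde k D') z / poly D' z"
  shows "\<exists>t::real. t \<noteq> 0 \<and> D' = smult (of_real t) D"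
proof -
  have cross: "D * tilde k D' = D' * tilde k D"
  proof (rule poly_eqI_infinite[of "ball 0 1"])
    show "infinite (ball (0::complex) 1)"
      by (intro uncountable_infinite uncountable_ball) simp
    fix z :: complex assume z: "z \<in> ball 0 1"
    then have "poly D z \<noteq> 0" "poly D' z \<noteq> 0" using D(2) D'(2) by auto
    then show "poly (D * tilde k D') z = poly (D' * tilde k D) z"
      using eq[OF z] by (simp add: field_simps)
  qed
  have "D dvd D' * tilde k D" "D' dvd D * tilde k D'"
    using cross by (metis dvd_triv_left)+
  then have "D dvd D'" "D' dvd D"
    using coprime_tilde[OF D(2) D(2) D(1)] coprime_tilde[OF D'(2) D'(2) D'(1)]
    by (simp_all add: coprime_dvd_mult_left_iff)
  moreover have "D \<noteq> 0" "D' \<noteq> 0" using D(2)[of 0] D'(2)[of 0] by auto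
  ultimately have "degree D' = degree D" by (intro antisym dvd_imp_degree_le)
  moreover obtain U where U: "D' = D * U" using \<open>D dvd D'\<close> by auto
  ultimately have "degree U = 0"
    using \<open>D \<noteq> 0\<close> \<open>D' \<noteq> 0\<close> by (auto simp: degree_mult_eq)
  then obtain c where "U = [:c:]" by (rule degree_eq_zeroE)
  then have c: "D' = smult c D" using U by simp
  have D1: "poly D 1 \<noteq> 0" using D(2)[of 1] by simp
  have "cnj c * (poly D 1 * cnj (poly D 1)) = c * (poly D 1 * cnj (poly D 1))"
    using arg_cong[OF cross, of "\<lambda>p. poly p 1"] D(1)
    by (simp add: c tilde_smult poly_tilde_circle mult_ac)
  then have "cnj c = c" using D1 by simp
  then have "c = of_real (Re c)" by (simp add: complex_eq_iff)
  moreover have "c \<noteq> 0" using c \<open>D' \<noteq> 0\<close> by auto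
  ultimately show ?thesis using c by (intro exI[of _ "Re c"]) auto
qed

text \<open>
  The reality of \<open>t\<close> is what makes scaling compatible with reflection, which conjugates scalars.
\<close>
lemma inner_representation_smult:
  assumes rep: "inner_representation p n k \<Phi> E D" and t: "t \<noteq> 0"
    and D': "D' = smult (of_real t) D"
    and E': "\<And>i. i \<in> {1..n-1} \<Longrightarrow> E' i = smult (of_real t ^ p) (E i)"
  shows "inner_representation p n k \<Phi> E' D'"
proof -
  have E: "\<And>i. i \<in> {1..n-1} \<Longrightarrow> E i = tilde (p * k) (E (n - i))"
    using rep unfolding inner_representation_def by blast
  have q: "(\<lambda>z. poly (E' i) z / poly D' z ^ p) = (\<lambda>z. poly (E i) z / poly D z ^ p)"
    if "i \<in> {1..n-1}" for i
    using E'[OF that] t by (simp add: D' power_mult_distrib fun_eq_iff)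
  have qn: "(\<lambda>z. poly (tilde k D') z / poly D' z) = (\<lambda>z. poly (tilde k D) z / poly D z)"
    using t by (simp add: D' tilde_smult fun_eq_iff)
  show ?thesis
    unfolding inner_representation_def
  proof (intro conjI ballI)
    fix i assume i: "i \<in> {1..n-1}"
    then have i': "n - i \<in> {1..n-1}" by auto
    show "degree (E' i) \<le> p * k"
      using rep i E'[OF i] t by (auto simp: inner_representation_def)
    show "eq_on_closed_disc (\<lambda>z. \<Phi> z i) (\<lambda>z. poly (E' i) z / poly D' z ^ p)"
      using rep i unfolding q[OF i] by (auto simp: inner_representation_def)
    have "E' i = smult (cnj (of_real t ^ p)) (tilde (p * k) (E (n - i)))"
      using E'[OF i] E[OF i] by simp
    then show "E' i = tilde (p * k) (E' (n - i))"
      unfolding E'[OF i'] tilde_smult .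
    fix z :: complex assume z: "z \<in> cball 0 1"
    have "norm (poly (E i) z) \<le> real ((n-1 choose i) + (n-1 choose (n-i))) * norm (poly D z) ^ p"
      using rep i z unfolding inner_representation_def by blast
    then have "\<bar>t\<bar> ^ p * norm (poly (E i) z)
        \<le> \<bar>t\<bar> ^ p * (real ((n-1 choose i) + (n-1 choose (n-i))) * norm (poly D z) ^ p)"
      by (intro mult_left_mono) auto
    then show "norm (poly (E' i) z) \<le> real ((n-1 choose i) + (n-1 choose (n-i))) * norm (poly D' z) ^ p"
      using E'[OF i] by (simp add: D' norm_mult norm_power power_mult_distrib mult_ac)
  qed (use rep t qn in \<open>auto simp: D' inner_representation_def\<close>)
qed

lemma inner_representation_unique:
  assumes rep: "inner_representation p n k \<Phi> E D" and rep': "inner_representation p n k \<Phi> E' D'"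
  shows "\<exists>t::real. t \<noteq> 0 \<and> D' = smult (of_real t) D \<and>
    (\<forall>i\<in>{1..n-1}. E' i = smult (of_real t ^ p) (E i))"
proof -
  have D: "degree D \<le> k" "\<And>z. z \<in> cball 0 1 \<Longrightarrow> poly D z \<noteq> 0"
    "\<And>z. z \<in> ball 0 1 \<Longrightarrow> \<Phi> z n = poly (tilde k D) z / poly D z"
    "\<And>i z. i \<in> {1..n-1} \<Longrightarrow> z \<in> ball 0 1 \<Longrightarrow> \<Phi> z i = poly (E i) z / poly D z ^ p"
    using rep unfolding inner_representation_def eq_on_closed_disc_def by blast+
  have D': "degree D' \<le> k" "\<And>z. z \<in> cball 0 1 \<Longrightarrow> poly D' z \<noteq> 0"
    "\<And>z. z \<in> ball 0 1 \<Longrightarrow> \<Phi> z n = poly (tilde k D') z / poly D' z"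
    "\<And>i z. i \<in> {1..n-1} \<Longrightarrow> z \<in> ball 0 1 \<Longrightarrow> \<Phi> z i = poly (E' i) z / poly D' z ^ p"
    using rep' unfolding inner_representation_def eq_on_closed_disc_def by blast+
  obtain t :: real where t: "t \<noteq> 0" "D' = smult (of_real t) D"
    using blaschke_denominator_unique[OF D(1,2) D'(1,2)] D(3) D'(3) by metis
  have "E' i = smult (of_real t ^ p) (E i)" if i: "i \<in> {1..n-1}" for i
  proof (rule poly_eqI_infinite[of "ball 0 1"])
    show "infinite (ball (0::complex) 1)"
      by (intro uncountable_infinite uncountable_ball) simp
    fix z :: complex assume z: "z \<in> ball 0 1"
    then have "poly D z \<noteq> 0" using D(2) by auto
    then show "poly (E' i) z = poly (smult (of_real t ^ p) (E i)) z"
      using D(4)[OF i z] D'(4)[OF i z] t by (simp add: power_mult_distrib field_simps)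
  qed
  with t show ?thesis by blast
qed

theorem theorem4p8:
  fixes m p n k :: nat and \<Phi> :: "complex \<Rightarrow> nat \<Rightarrow> complex"
  assumes "m > 0" and "p > 0" and "p dvd m" and "n \<ge> 2"
    and "rational_Theta_inner m p n \<Phi>"
    and "inner_degree p n \<Phi> = p * k"
  shows "(\<exists>E D. inner_representation p n k \<Phi> E D) \<and>
    (\<forall>E D. inner_representation p n k \<Phi> E D \<longrightarrow>
      (\<forall>E' D'. inner_representation p n k \<Phi> E' D' \<longleftrightarrow>
        (\<exists>t::real. t \<noteq> 0 \<and> D' = smult (of_real t) D \<and>
          (\<forall>i\<in>{1..n-1}. E' i = smult (of_real t ^ p) (E i)))))"
proof (intro conjI allI impI)
  show "\<exists>E D. inner_representation p n k \<Phi> E D"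
    using assms(2-6) by (rule inner_representation_exists)
  fix E D E' D' assume rep: "inner_representation p n k \<Phi> E D"
  show "inner_representation p n k \<Phi> E' D' \<longleftrightarrow>
      (\<exists>t::real. t \<noteq> 0 \<and> D' = smult (of_real t) D \<and>
        (\<forall>i\<in>{1..n-1}. E' i = smult (of_real t ^ p) (E i)))"
  proof
    assume "inner_representation p n k \<Phi> E' D'"
    then show "\<exists>t::real. t \<noteq> 0 \<and> D' = smult (of_real t) D \<and>
        (\<forall>i\<in>{1..n-1}. E' i = smult (of_real t ^ p) (E i))"
      by (rule inner_representation_unique[OF rep])
  qed (use inner_representation_smult[OF rep] in blast)
qed

end
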